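(* If $0<\lambda\le4/3$ and $f(z)=z+\sum_{n=2}^\infty a_nz^n$ belongs to $\mathcal{R}$, then for all $n\ge2$ we have $$|\lambda a_n^2-a_{2n-1}|\le\frac{2}{2n-1}.$$ For $\lambda<4/3$ and any fixed $n\ge2$, equality holds only for the functions of the following form (and for their rotations): $$f(z)=\sum_{k=1}^{2n-2}m_k\left(2e^{-i\theta_k}\log\frac{1}{1-e^{i\theta_k}z}-z\right)=\sum_{k=1}^{2n-2}2m_ke^{-i\theta_k}\log\frac{1}{1-e^{i\theta_k}z}-z,$$ where $$0\le m_k\le1,\qquad\theta_k=\frac{(2k+1)\pi}{2n-2},\qquad\sum_{k=1}^{n-1}m_{2k}=\sum_{k=1}^{n-1}m_{2k-1}=\frac12 .$$
   Context: $\mathbb{D}=\{z\in\mathbb{C}:|z|<1\}$ is the open unit disk and $\mathcal{R}$ is the (Noshiro-Warschawski) class of all functions $f$ analytic in $\mathbb{D}$ with $\mathrm{Re}\,f'(z)>0$ for all $z\in\mathbb{D}$ and $f(0)=f'(0)-1=0$. The branch of the logarithm is defined so that $\log1=0$. A rotation of a function $f$ is a function of the form $f_c(z)=\overline{c}f(cz)$ with $c\in\mathbb{C}$, $|c|=1$. In the last expression for $f$, the term $-z$ is outside the sum. *)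

theory Defs
  imports "HOL-Complex_Analysis.Complex_Analysis"
begin

definition class_R :: "(complex \<Rightarrow> complex) set" where
  "class_R = {f. f holomorphic_on ball 0 1 \<and> (\<forall>z\<in>ball 0 1. Re (deriv f z) > 0) \<and>
                 f 0 = 0 \<and> deriv f 0 - 1 = 0}"

definition taylor_coeff :: "(complex \<Rightarrow> complex) \<Rightarrow> nat \<Rightarrow> complex" where
  "taylor_coeff f n = fps_nth (fps_expansion f 0) n"

definition rotation :: "complex \<Rightarrow> (complex \<Rightarrow> complex) \<Rightarrow> complex \<Rightarrow> complex" where
  "rotation c f z = cnj c * f (c * z)"

definition angle :: "nat \<Rightarrow> nat \<Rightarrow> real" where
  "angle n k = (2 * real k + 1) * pi / (2 * real n - 2)"

(* For z in the unit disk, 1 / (1 - exp (i t) z) lies in the right half-plane, so the principal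
   branch ln is analytic there and is the branch with log 1 = 0. *)

definition extremal :: "nat \<Rightarrow> (nat \<Rightarrow> real) \<Rightarrow> complex \<Rightarrow> complex" where
  "extremal n m z =
     (\<Sum>k=1..2*n-2. of_real (m k) *
        (2 * exp (- \<i> * of_real (angle n k)) * ln (1 / (1 - exp (\<i> * of_real (angle n k)) * z)) - z))"

(* Unlike in extremal, the term - z is outside the sum; the two agree because the weights add up
   to 1. *)
definition extremal' :: "nat \<Rightarrow> (nat \<Rightarrow> real) \<Rightarrow> complex \<Rightarrow> complex" where
  "extremal' n m z =
     (\<Sum>k=1..2*n-2. 2 * of_real (m k) * exp (- \<i> * of_real (angle n k)) *
        ln (1 / (1 - exp (\<i> * of_real (angle n k)) * z))) - z"

definition admissible_weights :: "nat \<Rightarrow> (nat \<Rightarrow> real) \<Rightarrow> bool" where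
  "admissible_weights n m \<longleftrightarrow>
     (\<forall>k\<in>{1..2*n-2}. 0 \<le> m k \<and> m k \<le> 1) \<and>
     (\<Sum>k=1..n-1. m (2*k)) = 1/2 \<and> (\<Sum>k=1..n-1. m (2*k-1)) = 1/2"

end

theory Submission
  imports Defs
begin

text \<open>
  Let \<open>p\<close> be the derivative of \<open>f\<close>. Its real part is positive and \<open>p 0 = 1\<close>, so its Taylor coefficients, extended to the
  negative integers by complex conjugation and with the value \<open>2\<close> at \<open>0\<close>, form a positive definite sequence \<open>c\<close>
  (\<open>positive_definite_coefficients\<close>). With \<open>N = n - 1\<close>, the functional in question is
  \<open>\<bar>\<mu> * (c N)\<^sup>2 - c (2 * N)\<bar> / (2 * n - 1)\<close>, where \<open>\<mu> = lam * (2 * n - 1) / n\<^sup>2\<close> lies in \<open>{0<..1}\<close>.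

  Positivity of the \<open>3 \<times> 3\<close> Toeplitz matrix at the positions \<open>0\<close>, \<open>N\<close>, \<open>2 * N\<close> gives
  \<open>\<bar>c (2 * N) - (c N)\<^sup>2 / 2\<bar> \<le> 2 - \<bar>c N\<bar>\<^sup>2 / 2\<close> (\<open>positive_definite_second_coeff\<close>), and the triangle inequality
  turns this into the bound \<open>2 - (1/2 - \<bar>\<mu> - 1/2\<bar>) * \<bar>c N\<bar>\<^sup>2\<close> for the functional in \<open>\<mu>\<close>. This is at most \<open>2\<close>.

  If \<open>lam < 4/3\<close>, then \<open>\<mu> < 1\<close> and equality forces \<open>c N = 0\<close> and \<open>\<bar>c (2 * N)\<bar> = 2\<close>. A rotation
  achieves \<open>c (2 * N) = -2\<close>. The Toeplitz form then vanishes on a vector supported on \<open>0\<close> and \<open>2 * N\<close>, and so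
  \<open>c (k + 2 * N) = - c k\<close> for all \<open>k\<close> (\<open>positive_definite_antiperiodic\<close>). An antiperiodic sequence is a
  combination of characters at the roots of \<open>\<zeta> ^ (2 * N) = -1\<close>, and positive definiteness makes the weights
  nonnegative (\<open>positive_definite_discrete\<close>). The condition \<open>c N = 0\<close> says that the weights
  of even and of odd index have equal sums. Integrating the series for \<open>p\<close> gives the logarithms in the
  extremal functions. Conversely, the coefficients of these functions are explicit and attain equality.
\<close>

section \<open>Positive definite sequences from functions with positive real part\<close>

text \<open>
  The positions \<open>d j\<close> in the form are arbitrary and may repeat, so the form can be tested on a few
  sparse frequencies, and coinciding positions need no separate treatment. The symmetry clause makes the form real, which is why
  a bound on its real part says all there is to say.\<close>

definition positive_definite :: "(int \<Rightarrow> complex) \<Rightarrow> bool" where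
  "positive_definite c \<longleftrightarrow> (\<forall>d. c (- d) = cnj (c d)) \<and>
     (\<forall>n x d. 0 \<le> Re (\<Sum>j<(n::nat). \<Sum>l<n. x j * cnj (x l) * c (d j - d l)))"

text \<open>
  For \<open>a 0 = 1\<close> the value at \<open>0\<close> is \<open>2\<close>. Thus, if \<open>a\<close> lists the Taylor coefficients of \<open>p\<close> at \<open>0\<close>,
  these are the Fourier coefficients of the boundary measure of \<open>2 * Re p\<close>. The sum of the two one-sided
  pieces reduces positivity to the analytic piece alone.\<close>

definition hermitian_extension :: "(nat \<Rightarrow> complex) \<Rightarrow> int \<Rightarrow> complex" where
  "hermitian_extension a d =
     (if 0 \<le> d then a (nat d) else 0) + cnj (if d \<le> 0 then a (nat (- d)) else 0)"

text \<open>
  Cauchy's formula for the derivatives at the centre, with the circle parametrised by its angle.\<close>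

lemma circle_mean_higher_deriv:
  assumes hol: "g holomorphic_on ball 0 1" and r: "0 < r" "r < 1"
  shows "((\<lambda>t. g (of_real r * cis t) * cis (- (real k * t))) has_integral
           of_real (2 * pi) * ((deriv ^^ k) g 0 / fact k * of_real r ^ k)) {0..2*pi}"
proof -
  have "cball (0::complex) r \<subseteq> ball 0 1" "ball (0::complex) r \<subseteq> ball 0 1"
    using r by auto
  then have "continuous_on (cball 0 r) g" "g holomorphic_on ball 0 r"
    using hol holomorphic_on_imp_continuous_on holomorphic_on_subset by blast+
  then have "((\<lambda>u. g u / (u - 0) ^ Suc k) has_contour_integral
               2 * pi * \<i> / fact k * (deriv ^^ k) g 0) (circlepath 0 r)"
    by (rule Cauchy_has_contour_integral_higher_derivative_circlepath) (use r in auto)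
  then have "((\<lambda>t. g (r * cis t) / (r * cis t) ^ Suc k * r * \<i> * cis t) has_integral
               2 * pi * \<i> / fact k * (deriv ^^ k) g 0) {0..2*pi}"
    unfolding circlepath_def
    by (subst (asm) has_contour_integral_part_circlepath_iff) auto
  then have "((\<lambda>t. of_real r ^ k / \<i> * (g (r * cis t) / (r * cis t) ^ Suc k * r * \<i> * cis t)) has_integral
               of_real r ^ k / \<i> * (2 * pi * \<i> / fact k * (deriv ^^ k) g 0)) {0..2*pi}"
    by (rule has_integral_mult_right)
  moreover have "of_real r ^ k / \<i> * (g (r * cis t) / (r * cis t) ^ Suc k * r * \<i> * cis t)
      = g (r * cis t) * cis (- (real k * t))" for t
  proof -
    have "cis t ^ k * cis (- (real k * t)) = 1"
      by (simp add: Complex.DeMoivre cis_mult)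
    then show ?thesis
      using r by (simp add: power_mult_distrib field_simps)
  qed
  ultimately show ?thesis by (simp add: field_simps)
qed

lemma circle_mean_zero:
  assumes hol: "g holomorphic_on ball 0 1" and r: "0 < r" "r < 1" and "0 < m"
  shows "((\<lambda>t. g (of_real r * cis t) * cis (real m * t)) has_integral 0) {0..2*pi}"
proof -
  have "(\<lambda>z. g z * z ^ m) holomorphic_on ball 0 1"
    using hol by (intro holomorphic_intros)
  from circle_mean_higher_deriv[OF this r, of 0] \<open>0 < m\<close>
  have "((\<lambda>t. g (r * cis t) * (r * cis t) ^ m) has_integral 0) {0..2*pi}"
    by (simp add: zero_power)
  from has_integral_mult_right[OF this, of "inverse (of_real r ^ m)"]
  moreover have "inverse (of_real r ^ m) * (g (r * cis t) * (r * cis t) ^ m)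
      = g (r * cis t) * cis (real m * t)" for t
    using r by (simp add: power_mult_distrib flip: Complex.DeMoivre)
  ultimately show ?thesis by simp
qed

text \<open>
  On the circle of radius \<open>r\<close>, the mean of \<open>g\<close> against the square of the modulus of a trigonometric
  polynomial has nonnegative real part. Expanding the square and taking the mean term by term turns this into
  the asserted form with damping factors \<open>r ^ k\<close>, which disappear as \<open>r\<close> tends to \<open>1\<close>.\<close>

lemma toeplitz_form_Re_nonneg:
  fixes d :: "nat \<Rightarrow> int" and x :: "nat \<Rightarrow> complex"
  assumes hol: "g holomorphic_on ball 0 1"
    and pos: "\<And>z. z \<in> ball 0 1 \<Longrightarrow> 0 \<le> Re (g z)"
    and a: "\<And>k. a k = (deriv ^^ k) g 0 / fact k"
  shows "0 \<le> Re (\<Sum>j<n. \<Sum>l<n. x j * cnj (x l) *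
                    (if 0 \<le> d j - d l then a (nat (d j - d l)) else 0))"
proof -
  define A where "A e = (if 0 \<le> e then a (nat e) else 0)" for e :: int
  define P where "P r = (\<Sum>j<n. \<Sum>l<n. x j * cnj (x l) *
      (A (d j - d l) * of_real r ^ nat (d j - d l)))" for r
  have nonneg: "0 \<le> Re (P r)" if r: "0 < r" "r < 1" for r
  proof -
    \<comment> \<open>Negative frequencies are annihilated because \<open>g\<close> is analytic.\<close>
    have mean: "((\<lambda>t. g (r * cis t) * cis (- (of_int e * t))) has_integral
                  of_real (2 * pi) * (A e * of_real r ^ nat e)) {0..2*pi}" for e
      using circle_mean_higher_deriv[OF hol r, of "nat e"] circle_mean_zero[OF hol r, of "nat (- e)"]
      by (cases "0 \<le> e") (auto simp: A_def a)
    define S where "S t = (\<Sum>j<n. x j * cis (- (of_int (d j) * t)))" for t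
    have "((\<lambda>t. \<Sum>j<n. \<Sum>l<n. x j * cnj (x l) * (g (r * cis t) * cis (- (of_int (d j - d l) * t))))
             has_integral (\<Sum>j<n. \<Sum>l<n. x j * cnj (x l) *
               (of_real (2 * pi) * (A (d j - d l) * of_real r ^ nat (d j - d l))))) {0..2*pi}"
      by (intro has_integral_sum has_integral_mult_right mean) auto
    moreover have "(\<Sum>j<n. \<Sum>l<n. x j * cnj (x l) * (g (r * cis t) * cis (- (of_int (d j - d l) * t))))
        = of_real ((cmod (S t))\<^sup>2) * g (r * cis t)" for t
    proof -
      have "of_real ((cmod (S t))\<^sup>2) = S t * cnj (S t)"
        by (simp only: complex_norm_square)
      also have "\<dots> = (\<Sum>j<n. \<Sum>l<n. x j * cnj (x l) * cis (- (of_int (d j - d l) * t)))"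
        by (simp add: S_def sum_product cis_cnj cis_mult algebra_simps
              flip: cis_mult[of "_ * t" "- (_ * t)"])
      finally show ?thesis
        by (simp only: sum_distrib_right mult_ac) (simp only: sum_distrib_left mult_ac)
    qed
    moreover have "(\<Sum>j<n. \<Sum>l<n. x j * cnj (x l) *
               (of_real (2 * pi) * (A (d j - d l) * of_real r ^ nat (d j - d l)))) = of_real (2 * pi) * P r"
      by (simp add: P_def sum_distrib_left mult_ac)
    ultimately have "((\<lambda>t. of_real ((cmod (S t))\<^sup>2) * g (r * cis t)) has_integral of_real (2 * pi) * P r) {0..2*pi}"
      by simp
    from has_integral_linear[OF this bounded_linear_Re]
    have "((\<lambda>t. (cmod (S t))\<^sup>2 * Re (g (r * cis t))) has_integral 2 * pi * Re (P r)) {0..2*pi}"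
      by (simp add: o_def)
    then have "0 \<le> 2 * pi * Re (P r)"
      by (rule has_integral_nonneg) (use r in \<open>auto intro!: pos mult_nonneg_nonneg simp: norm_mult\<close>)
    then show ?thesis using pi_gt_zero by (auto simp: zero_le_mult_iff)
  qed
  have "((\<lambda>r. Re (P r)) \<longlongrightarrow> Re (P 1)) (at_left 1)"
    unfolding P_def by (intro tendsto_intros)
  moreover have "eventually (\<lambda>r. 0 \<le> Re (P r)) (at_left 1)"
    by (rule eventually_mono[OF eventually_at_left_real[of 0 1]]) (use nonneg in auto)
  ultimately have "0 \<le> Re (P 1)"
    by (rule tendsto_lowerbound) auto
  then show ?thesis by (simp add: P_def A_def)
qed

text \<open>
  The form of the hermitian extension is that of its analytic half plus the complex conjugate,
  since the second half contributes the first one with the two summation indices interchanged.\<close>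

lemma positive_definite_coefficients:
  assumes hol: "g holomorphic_on ball 0 1"
    and pos: "\<And>z. z \<in> ball 0 1 \<Longrightarrow> 0 \<le> Re (g z)"
  shows "positive_definite (hermitian_extension (\<lambda>k. (deriv ^^ k) g 0 / fact k))"
proof -
  define a where "a k = (deriv ^^ k) g 0 / fact k" for k
  define A where "A e = (if 0 \<le> e then a (nat e) else 0)" for e :: int
  have c: "hermitian_extension a e = A e + cnj (A (- e))" for e
    by (simp add: hermitian_extension_def A_def)
  have "0 \<le> Re (\<Sum>j<n. \<Sum>l<n. x j * cnj (x l) * hermitian_extension a (d j - d l))"
    for n :: nat and x and d :: "nat \<Rightarrow> int"
  proof -
    define J where "J = (\<Sum>j<n. \<Sum>l<n. x j * cnj (x l) * A (d j - d l))"
    have "cnj J = (\<Sum>l<n. \<Sum>j<n. cnj (x j) * x l * cnj (A (d j - d l)))"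
      unfolding J_def by (subst sum.swap) simp
    then have "(\<Sum>j<n. \<Sum>l<n. x j * cnj (x l) * hermitian_extension a (d j - d l)) = J + cnj J"
      by (simp add: J_def c sum.distrib algebra_simps)
    moreover have "0 \<le> Re J"
      using toeplitz_form_Re_nonneg[OF hol pos a_def] by (simp add: J_def A_def)
    ultimately show ?thesis by simp
  qed
  then show ?thesis
    unfolding positive_definite_def a_def[symmetric] by (auto simp: c)
qed

text \<open>
  On coefficient sequences this is the rotation of a function by the unimodular number \<open>cis s\<close>;
  the phases can be absorbed in the test vector.\<close>

lemma positive_definite_modulate:
  assumes "positive_definite c"
  shows "positive_definite (\<lambda>d. c d * cis (of_int d * s))"
proof -
  have "0 \<le> Re (\<Sum>j<n. \<Sum>l<n. x j * cnj (x l) * (c (d j - d l) * cis (of_int (d j - d l) * s)))"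
    for n :: nat and x and d :: "nat \<Rightarrow> int"
  proof -
    define y where "y j = x j * cis (of_int (d j) * s)" for j
    have "0 \<le> Re (\<Sum>j<n. \<Sum>l<n. y j * cnj (y l) * c (d j - d l))"
      using assms by (auto simp: positive_definite_def)
    moreover have "y j * cnj (y l) * c (d j - d l)
        = x j * cnj (x l) * (c (d j - d l) * cis (of_int (d j - d l) * s))" for j l
    proof -
      have "cis (of_int (d j - d l) * s) = cis (of_int (d j) * s) * cis (- (of_int (d l) * s))"
        by (simp add: cis_mult algebra_simps)
      then show ?thesis by (simp add: y_def cis_cnj)
    qed
    ultimately show ?thesis by simp
  qed
  with assms show ?thesis by (simp add: positive_definite_def cis_cnj)
qed

section \<open>Consequences of positive definiteness\<close>

text \<open>
  Half of the form at the three positions \<open>d\<close>, \<open>e\<close>, \<open>f\<close>, with the conjugate off-diagonal terms collected.\<close>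

lemma positive_definite_three:
  assumes "positive_definite c" "c 0 = 2"
  shows "0 \<le> cmod x ^ 2 + cmod y ^ 2 + cmod z ^ 2 +
     Re (y * cnj x * c (e - d) + z * cnj y * c (f - e) + z * cnj x * c (f - d))"
proof -
  define X where "X j = (if j = 0 then x else if j = 1 then y else z)" for j :: nat
  define D where "D j = (if j = 0 then d else if j = 1 then e else f)" for j :: nat
  have h: "c (- k) = cnj (c k)" for k using assms by (simp add: positive_definite_def)
  have sw: "c (d - e) = cnj (c (e - d))" "c (e - f) = cnj (c (f - e))" "c (d - f) = cnj (c (f - d))"
    using h[of "e - d"] h[of "f - e"] h[of "f - d"] by simp_all
  have n: "Re (w * cnj w) = cmod w ^ 2" for w
    by (simp add: complex_norm_square[symmetric] del: Re_complex_of_real)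
       (metis Re_complex_of_real)
  have Re_two: "Re (2 * w) = 2 * Re w" for w by simp
  have "0 \<le> Re (\<Sum>j<(3::nat). \<Sum>l<3. X j * cnj (X l) * c (D j - D l))"
    using assms(1) unfolding positive_definite_def by blast
  also have "(\<Sum>j<(3::nat). \<Sum>l<3. X j * cnj (X l) * c (D j - D l)) =
     2 * (x * cnj x + y * cnj y + z * cnj z) +
     ((y * cnj x * c (e - d) + z * cnj y * c (f - e) + z * cnj x * c (f - d)) +
     cnj (y * cnj x * c (e - d) + z * cnj y * c (f - e) + z * cnj x * c (f - d)))"
    by (simp add: numeral_3_eq_3 X_def D_def assms(2) sw algebra_simps)
  also have "Re \<dots> = 2 * (Re (x * cnj x) + Re (y * cnj y) + Re (z * cnj z) +
     Re (y * cnj x * c (e - d) + z * cnj y * c (f - e) + z * cnj x * c (f - d)))"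
    using Re_two by (simp only: plus_complex.sel complex_cnj cnj.sel distrib_left)
  finally show ?thesis by (simp only: n zero_le_mult_iff) auto
qed

lemma obtain_rotation:
  fixes w :: complex
  obtains u where "cmod u = 1" "u * w = of_real (cmod w)"
proof (cases "w = 0")
  case True then show ?thesis using that[of 1] by simp
next
  case False
  show ?thesis
  proof (rule that[of "cnj w / of_real (cmod w)"])
    show "cmod (cnj w / of_real (cmod w)) = 1" using False by (simp add: norm_divide)
    show "cnj w / of_real (cmod w) * w = of_real (cmod w)"
      using False by (simp add: complex_norm_square[symmetric] power2_eq_square field_simps)
  qed
qed

text \<open>
  The form is tested at the positions \<open>0\<close>, \<open>k\<close>, \<open>2 * k\<close>. For prescribed unimodular outer entries \<open>1\<close> and \<open>u\<close>
  the form is a quadratic function of the middle entry; its minimum is a Schur complement, and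
  turning \<open>u\<close> aligns the quantity to be estimated with the positive axis.\<close>

lemma positive_definite_second_coeff:
  assumes "positive_definite c" "c 0 = 2"
  shows "cmod (c (2 * k) - (c k)\<^sup>2 / 2) \<le> 2 - (cmod (c k))\<^sup>2 / 2"
proof -
  define b where "b = c k"
  obtain u where u: "cmod u = 1" "u * (b\<^sup>2 / 2 - c (2 * k)) = of_real (cmod (b\<^sup>2 / 2 - c (2 * k)))"
    by (rule obtain_rotation)
  \<comment> \<open>The minimiser of the form in its middle entry.\<close>
  define y where "y = - (cnj b + b * u) / 2"
  have "0 \<le> cmod 1 ^ 2 + cmod y ^ 2 + cmod u ^ 2 + Re (y * cnj 1 * b + u * cnj y * b + u * cnj 1 * c (2*k))"
    using positive_definite_three[OF assms, of 1 y u k 0 "2*k"] by (simp add: b_def)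
  also have "\<dots> = Re (2 + y * cnj y + y * b + u * cnj y * b + u * c (2 * k))"
    using u(1) by (simp flip: complex_norm_square of_real_power)
  also have "2 + y * cnj y + y * b + u * cnj y * b + u * c (2 * k)
     = 2 - b * cnj b / 2 - u * (b\<^sup>2 / 2 - c (2 * k)) + (cnj (u * b\<^sup>2) - u * b\<^sup>2) / 4"
  proof -
    have "u * cnj u = 1" using u(1) by (simp flip: complex_norm_square)
    then show ?thesis
      unfolding y_def by (simp add: field_simps power2_eq_square)
  qed
  also have "Re \<dots> = 2 - (cmod b)\<^sup>2 / 2 - cmod (b\<^sup>2 / 2 - c (2 * k))"
  proof -
    have "Re (cnj w - w) = 0" for w by simp
    then show ?thesis
      unfolding u(2) complex_norm_square[symmetric] by (simp only: plus_complex.sel minus_complex.sel Re_divide_numeral) simp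
  qed
  finally show ?thesis by (simp add: b_def norm_minus_commute)
qed

text \<open>
  If \<open>c 0 = 2\<close> and \<open>c M = -2\<close>, the test vector with entries \<open>1\<close> at \<open>0\<close> and \<open>M\<close> has form zero. In a positive
  semidefinite form such a vector is orthogonal to all others, in particular to a point mass
  at \<open>k + M\<close>, which is the assertion. In terms of the representing measure: the function
  \<open>1 + \<zeta> ^ M\<close> vanishes almost everywhere, so the measure lives on the \<open>M\<close>-th roots of \<open>-1\<close>.\<close>

lemma positive_definite_antiperiodic:
  assumes "positive_definite c" "c 0 = 2" "c M = -2"
  shows "c (k + M) = - c k"
proof -
  define s where "s = c (k + M) + c k"
  \<comment> \<open>The multiple \<open>- cnj s / 2\<close> of the point mass gives the form the value \<open>- (cmod s)\<^sup>2 / 4\<close>, up to a positive factor.\<close>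
  have "0 \<le> cmod 1 ^ 2 + cmod 1 ^ 2 + cmod (- cnj s / 2) ^ 2
      + Re (1 * cnj 1 * c M + (- cnj s / 2) * cnj 1 * c k + (- cnj s / 2) * cnj 1 * c (k + M))"
    using positive_definite_three[OF assms(1,2), of 1 1 "- cnj s / 2" M 0 "k + M"] by simp
  also have "\<dots> = (cmod s)\<^sup>2 / 4 - Re (s * cnj s) / 2"
  proof -
    have "1 * cnj 1 * c M + (- cnj s / 2) * cnj 1 * c k + (- cnj s / 2) * cnj 1 * c (k + M)
        = -2 - s * cnj s / 2"
      unfolding s_def by (simp add: assms(3) field_simps)
    then show ?thesis by (simp only: norm_divide norm_minus_cancel complex_mod_cnj) (simp add: power_divide)
  qed
  also have "\<dots> = - (cmod s)\<^sup>2 / 4"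
    by (simp flip: complex_norm_square of_real_power)
  finally have "s = 0" by simp
  then show ?thesis by (simp add: s_def eq_neg_iff_add_eq_0)
qed

section \<open>Antiperiodic sequences as discrete Fourier transforms\<close>

lemma sum_over_period:
  fixes g :: "int \<Rightarrow> complex"
  assumes per: "\<And>d. g (d + int M) = g d"
  shows "(\<Sum>j<M. g (int j + s)) = (\<Sum>j<M. g (int j))"
proof -
  have step: "(\<Sum>j<M. g (int j + (s + 1))) = (\<Sum>j<M. g (int j + s))" for s
  proof -
    have "g s + (\<Sum>j<M. g (int j + (s + 1))) = (\<Sum>j<M. g (int j + s)) + g (int M + s)"
      using sum.lessThan_Suc_shift[of "\<lambda>j. g (int j + s)" M] by (simp add: algebra_simps)
    then show ?thesis using per[of s] by (simp add: add.commute)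
  qed
  show ?thesis
  proof (induction s rule: int_induct[where k = 0])
    case (step1 i) then show ?case using step[of i] by simp
  next
    case (step2 i) then show ?case using step[of "i - 1"] by simp
  qed simp
qed

text \<open>
  The angles of the \<open>M\<close> roots of \<open>\<zeta> ^ M = -1\<close>, taken for \<open>k = 1, \<dots>, M\<close>.\<close>

definition node :: "nat \<Rightarrow> nat \<Rightarrow> real" where
  "node M k = (2 * real k + 1) * pi / real M"

lemma cis_node_period: "0 < M \<Longrightarrow> cis (real M * node M k) = -1"
proof -
  assume "0 < M"
  then have "real M * node M k = 2 * pi * real k + pi"
    by (simp add: node_def field_simps)
  then show ?thesis by (simp only: cis_mult[symmetric]) (simp add: cis_multiple_2pi)
qed

lemma sum_cis_nodes:
  assumes "0 < d" "d < M"
  shows "(\<Sum>k=1..M. cis (- (real d * node M k))) = 0"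
proof -
  define q where "q = cis (- (2 * pi * real d / real M))"
  have "q ^ M = cis (2 * pi * of_int (- int d))"
    using assms by (simp add: q_def Complex.DeMoivre)
  then have qM: "q ^ M = 1" by (simp only: cis_multiple_2pi Ints_of_int)
  have "q \<noteq> 1"
  proof
    assume "q = 1"
    then have "cos (2 * pi * real d / real M) = 1"
      by (simp add: q_def complex_eq_iff)
    then obtain i :: int where "2 * pi * real d / real M = of_int i * 2 * pi"
      by (auto simp: cos_one_2pi_int)
    then have "real d = of_int i * real M"
      using assms by (simp add: field_simps)
    then have "int d = i * int M"
      by (metis of_int_eq_iff of_int_mult of_int_of_nat_eq)
    then have "int M dvd int d" by simp
    from zdvd_imp_le[OF this] assms show False by simp
  qed
  have "cis (- (real d * node M k)) = cis (- (real d * pi / real M)) * q ^ k" for k :: nat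
  proof -
    have "- (real d * node M k) = - (real d * pi / real M) + real k * - (2 * pi * real d / real M)"
      using assms by (simp add: node_def field_simps)
    then show ?thesis by (simp only: q_def Complex.DeMoivre cis_mult)
  qed
  then have "(\<Sum>k=1..M. cis (- (real d * node M k))) = cis (- (real d * pi / real M)) * (\<Sum>k=1..M. q ^ k)"
    by (simp add: sum_distrib_left)
  also have "(\<Sum>k=1..M. q ^ k) = q * (\<Sum>k<M. q ^ k)"
    by (simp add: sum_distrib_left sum.atLeast1_atMost_eq lessThan_atLeast0 sum.shift_bounds_nat_ivl)
  also have "(\<Sum>k<M. q ^ k) = 0"
    using \<open>q \<noteq> 1\<close> qM by (simp add: geometric_sum)
  finally show ?thesis by simp
qed

text \<open>
  This is the Herglotz representation in the case of a discrete measure: antiperiodicity confines the measure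
  to the nodes, so its masses can be written down by an inverse discrete Fourier transform. The mass at a node is
  a positive multiple of the form at the character of that node, and therefore nonnegative.\<close>

lemma positive_definite_discrete:
  assumes pd: "positive_definite c" and c0: "c 0 = 2" and M: "0 < M" and cM: "c (int M) = -2"
  obtains m :: "nat \<Rightarrow> real" where "\<And>k. 0 \<le> m k"
    "\<And>s. c s = 2 * (\<Sum>k=1..M. of_real (m k) * cis (of_int s * node M k))"
proof -
  define A where "A k = (\<Sum>d<M. c (int d) * cis (- (real d * node M k)))" for k
  have per: "c (d + int M) * cis (of_int (e - (d + int M)) * node M k) = c d * cis (of_int (e - d) * node M k)" for d e k
  proof -
    have "c (d + int M) = - c d"
      by (rule positive_definite_antiperiodic[OF pd c0 cM])
    moreover have "cis (of_int (e - d) * node M k) = cis (of_int (e - (d + int M)) * node M k) * cis (real M * node M k)"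
      by (simp add: cis_mult algebra_simps)
    ultimately show ?thesis by (simp add: cis_node_period[OF M])
  qed
  \<comment> \<open>The summand has period \<open>M\<close>, since the two sign changes cancel; hence any window of length \<open>M\<close> gives the same sum.\<close>
  have A_shift: "A k * cis (of_int s * node M k) = (\<Sum>d<M. c (int d + s) * cis (- (real d * node M k)))" for k s
  proof -
    have "(\<Sum>d<M. c (int d + s) * cis (of_int (s - (int d + s)) * node M k))
        = (\<Sum>d<M. c (int d) * cis (of_int (s - int d) * node M k))"
      by (rule sum_over_period[of "\<lambda>d. c d * cis (of_int (s - d) * node M k)"]) (rule per)
    also have "\<dots> = A k * cis (of_int s * node M k)"
      unfolding A_def sum_distrib_right
      by (intro sum.cong refl) (simp add: mult.assoc cis_mult algebra_simps)
    finally show ?thesis by simp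
  qed
  have A_real: "A k = of_real (Re (A k))" and A_nonneg: "0 \<le> Re (A k)" for k
  proof -
    define x where "x j = cis (- (real j * node M k))" for j :: nat
    have x: "x j * cnj (x l) * c (int j - int l) = c (int j + (- int l)) * cis (- (real j * node M k)) * cis (real l * node M k)" for j l
      by (simp add: x_def cis_cnj)
    have form: "(\<Sum>j<M. \<Sum>l<M. x j * cnj (x l) * c (int j - int l)) = of_nat M * A k"
    proof -
      have "(\<Sum>j<M. x j * cnj (x l) * c (int j - int l)) = A k" for l
        unfolding x sum_distrib_right[symmetric] A_shift[symmetric] by (simp add: mult.assoc cis_mult)
      then show ?thesis by (subst sum.swap) simp
    qed
    have "0 \<le> Re (\<Sum>j<M. \<Sum>l<M. x j * cnj (x l) * c (int j - int l))"
      using pd unfolding positive_definite_def by blast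
    then show "0 \<le> Re (A k)"
      using M by (simp add: form zero_le_mult_iff)
    have h: "cnj (c (int j - int l)) = c (int l - int j)" for j l
      using pd unfolding positive_definite_def by (metis minus_diff_eq)
    have "cnj (\<Sum>j<M. \<Sum>l<M. x j * cnj (x l) * c (int j - int l)) =
           (\<Sum>j<M. \<Sum>l<M. x j * cnj (x l) * c (int j - int l))"
      by (subst sum.swap) (simp add: h mult_ac)
    then have "cnj (A k) = A k"
      using M by (simp add: form)
    then show "A k = of_real (Re (A k))"
      by (metis Reals_cnj_iff of_real_Re)
  qed
  show ?thesis
  proof (rule that)
    show "0 \<le> Re (A k) / (2 * real M)" for k
      using A_nonneg by simp
    show "c s = 2 * (\<Sum>k=1..M. of_real (Re (A k) / (2 * real M)) * cis (of_int s * node M k))" for s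
    proof -
      \<comment> \<open>Orthogonality of the characters leaves only the term with \<open>d = 0\<close>.\<close>
      have "(\<Sum>k=1..M. A k * cis (of_int s * node M k)) =
            (\<Sum>d<M. c (int d + s) * (\<Sum>k=1..M. cis (- (real d * node M k))))"
        unfolding A_shift sum_distrib_left by (rule sum.swap)
      also have "\<dots> = (\<Sum>d<M. if d = 0 then c s * of_nat M else 0)"
        by (intro sum.cong refl) (simp add: sum_cis_nodes[simplified])
      also have "\<dots> = c s * of_nat M"
        using M by simp
      finally have "c s = (\<Sum>k=1..M. A k * cis (of_int s * node M k)) / of_nat M"
        using M by simp
      also have "\<dots> = 2 * (\<Sum>k=1..M. of_real (Re (A k) / (2 * real M)) * cis (of_int s * node M k))"
        unfolding sum_divide_distrib sum_distrib_left
        by (intro sum.cong refl, subst A_real) simp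
      finally show ?thesis .
    qed
  qed
qed

lemma sum_even_odd:
  fixes f :: "nat \<Rightarrow> 'a :: comm_monoid_add"
  shows "(\<Sum>k=1..2*N. f k) = (\<Sum>k=1..N. f (2*k)) + (\<Sum>k=1..N. f (2*k-1))"
  by (induction N) (simp_all add: add_ac)

lemma cis_node_half: "0 < N \<Longrightarrow> cis (real N * node (2*N) k) = \<i> * (-1) ^ k"
proof -
  assume "0 < N"
  then have "real N * node (2*N) k = real k * pi + pi / 2"
    by (simp add: node_def field_simps)
  then have "cis (real N * node (2*N) k) = cis (real k * pi) * \<i>"
    by (simp flip: cis_mult)
  then show ?thesis
    by (simp flip: Complex.DeMoivre)
qed

text \<open>
  At the middle frequency \<open>N\<close> the nodes alternate between \<open>\<i>\<close> and \<open>-\<i>\<close>. This is where the balance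
  between the weights of even and of odd index comes from.\<close>

lemma sum_cis_node_half:
  assumes "0 < N"
  shows "(\<Sum>k=1..2*N. of_real (m k) * cis (real N * node (2*N) k))
     = \<i> * of_real ((\<Sum>k=1..N. m (2*k)) - (\<Sum>k=1..N. m (2*k-1)))"
proof -
  have "(-1::complex) ^ (2 * k - 1) = -1" if "k \<in> {1..N}" for k
    using that by (intro uminus_power_if[THEN trans]) auto
  then show ?thesis
    unfolding cis_node_half[OF assms] sum_even_odd
    by (simp add: sum_negf sum_distrib_left algebra_simps)
qed

section \<open>The functional on positive definite sequences\<close>

lemma angle_eq_node: "2 \<le> n \<Longrightarrow> angle n k = node (2 * (n - 1)) k"
  by (simp add: angle_def node_def of_nat_diff)

text \<open>
  The bound for \<open>\<mu> = 1/2\<close> is the sharpest one; the triangle inequality carries it to the other \<open>\<mu>\<close>. For \<open>\<mu>\<close> strictly between \<open>0\<close> and \<open>1\<close>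
  the coefficient of \<open>(cmod (c k))\<^sup>2\<close> is negative, so that the value \<open>2\<close> is attained only with \<open>c k = 0\<close>.\<close>

lemma fekete_szego_positive_definite:
  assumes "positive_definite c" "c 0 = 2"
  shows "cmod (of_real \<mu> * (c k)\<^sup>2 - c (2 * k)) \<le> 2 - (1/2 - \<bar>\<mu> - 1/2\<bar>) * (cmod (c k))\<^sup>2"
proof -
  have "of_real \<mu> * (c k)\<^sup>2 - c (2 * k) = of_real (\<mu> - 1/2) * (c k)\<^sup>2 - (c (2 * k) - (c k)\<^sup>2 / 2)"
    by (simp add: algebra_simps)
  also have "cmod \<dots> \<le> cmod (of_real (\<mu> - 1/2) * (c k)\<^sup>2) + cmod (c (2 * k) - (c k)\<^sup>2 / 2)"
    by (rule norm_triangle_ineq4)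
  also have "\<dots> \<le> \<bar>\<mu> - 1/2\<bar> * (cmod (c k))\<^sup>2 + (2 - (cmod (c k))\<^sup>2 / 2)"
    using positive_definite_second_coeff[OF assms, of k]
    by (simp only: norm_mult norm_of_real norm_power add_left_mono)
  finally show ?thesis by (simp add: algebra_simps)
qed

section \<open>Convex combinations of logarithmic kernels\<close>

text \<open>
  For unimodular \<open>w\<close> this is the function vanishing at \<open>0\<close> whose derivative is the Herglotz kernel \<open>(1 + w * z) / (1 - w * z)\<close>;
  then \<open>cnj w\<close> is the reciprocal of \<open>w\<close>.\<close>

definition log_kernel :: "complex \<Rightarrow> complex \<Rightarrow> complex" where
  "log_kernel w z = 2 * cnj w * ln (1 / (1 - w * z)) - z"

lemma one_minus_not_nonpos:
  fixes u :: complex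
  assumes "cmod u < 1" shows "1 - u \<notin> \<real>\<^sub>\<le>\<^sub>0"
proof -
  have "Re u < 1" using assms complex_Re_le_cmod[of u] by simp
  then show ?thesis by (auto simp: complex_nonpos_Reals_iff)
qed

text \<open>
  The coefficient at \<open>k = 0\<close> is \<open>2 * 1 / 0 = 0\<close> by the conventions for division and for subtraction of
  natural numbers, so one formula covers all \<open>k\<close>.\<close>

lemma log_kernel_sums:
  assumes w: "cmod w = 1" and z: "z \<in> ball 0 1"
  shows "(\<lambda>k. (2 * w ^ (k - 1) / of_nat k - (if k = 1 then 1 else 0)) * z ^ k) sums log_kernel w z"
proof -
  have u: "cmod (w * z) < 1" using w z by (simp add: norm_mult)
  have "(\<lambda>k. - ((w * z) ^ k / of_nat k)) sums ln (1 - w * z)"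
    using Ln_series'[of "- (w * z)"] u by simp
  from sums_minus[OF this] have "(\<lambda>k. (w * z) ^ k / of_nat k) sums ln (1 / (1 - w * z))"
    using Ln_inverse[OF one_minus_not_nonpos[OF u]] by (simp add: inverse_eq_divide)
  from sums_diff[OF sums_mult[OF this, of "2 * cnj w"] sums_single[of 1 "\<lambda>k. z ^ k"]]
  have "(\<lambda>k. 2 * cnj w * ((w * z) ^ k / of_nat k) - (if k = 1 then z ^ k else 0)) sums log_kernel w z"
    by (simp add: log_kernel_def)
  moreover have "2 * cnj w * ((w * z) ^ k / of_nat k) - (if k = 1 then z ^ k else 0)
      = (2 * w ^ (k - 1) / of_nat k - (if k = 1 then 1 else 0)) * z ^ k" for k
  proof (cases k)
    case (Suc j)
    have "cnj w * w = 1" using w by (simp add: mult.commute flip: complex_norm_square)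
    moreover have "cnj w * (w * z) ^ k = (cnj w * w) * (w ^ j * z ^ k)"
      unfolding Suc by (simp add: power_mult_distrib mult_ac)
    ultimately have "cnj w * (w * z) ^ k = w ^ j * z ^ k" by (simp only: mult_1_left)
    then have "2 * cnj w * ((w * z) ^ k / of_nat k) = 2 * w ^ (k - 1) / of_nat k * z ^ k"
      by (simp only: Suc diff_Suc_1 times_divide_eq_right times_divide_eq_left mult.assoc)
    then show ?thesis by (simp only: left_diff_distrib) simp
  qed simp
  ultimately show ?thesis by simp
qed

lemma log_kernel_has_field_derivative:
  assumes w: "cmod w = 1" and z: "z \<in> ball 0 1"
  shows "(log_kernel w has_field_derivative (1 + w * z) / (1 - w * z)) (at z)"
proof -
  have u: "cmod (w * v) < 1" if "v \<in> ball 0 1" for v using w that by (simp add: norm_mult)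
  have ne: "1 - w * z \<noteq> 0" using one_minus_not_nonpos[OF u[OF z]] by auto
  have "cnj w * w = 1" using w by (simp add: mult.commute flip: complex_norm_square)
  then have "((\<lambda>v. 2 * cnj w * - ln (1 - w * v) - v) has_field_derivative (1 + w * z) / (1 - w * z)) (at z)"
    using one_minus_not_nonpos[OF u[OF z]] ne
    by (auto intro!: derivative_eq_intros simp: field_simps)
  then show ?thesis
  proof (rule has_field_derivative_transform_within_open)
    show "2 * cnj w * - ln (1 - w * v) - v = log_kernel w v" if "v \<in> ball 0 1" for v
      using Ln_inverse[OF one_minus_not_nonpos[OF u[OF that]]]
      by (simp add: log_kernel_def inverse_eq_divide)
  qed (use z in auto)
qed

lemma Re_cayley_pos:
  fixes u :: complex
  assumes "cmod u < 1" shows "0 < Re ((1 + u) / (1 - u))"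
proof -
  have ne: "1 - u \<noteq> 0" using assms by auto
  have "(1 + u) / (1 - u) = (1 + u) * cnj (1 - u) / of_real ((cmod (1 - u))\<^sup>2)"
    by (rule complex_div_cnj)
  moreover have "Re ((1 + u) * cnj (1 - u)) = 1 - (cmod u)\<^sup>2"
    unfolding cmod_power2 by (simp add: algebra_simps power2_eq_square)
  moreover have "(cmod u)\<^sup>2 < 1" using assms by (simp add: power_less_one_iff abs_square_less_1)
  ultimately show ?thesis using ne by (simp only: Re_divide_of_real) simp
qed

lemma taylor_coeff_eqI:
  assumes "\<And>z. z \<in> ball 0 1 \<Longrightarrow> (\<lambda>k. b k * z ^ k) sums f z"
  shows "taylor_coeff f n = b n"
proof -
  have "f has_fps_expansion Abs_fps b"
    by (rule has_fps_expansionI, rule eventually_nhds_in_open[of "ball 0 1", THEN eventually_mono])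
       (use assms in auto)
  then show ?thesis by (simp add: taylor_coeff_def fps_expansion_eqI)
qed

lemma taylor_coeff_sums:
  assumes "f holomorphic_on ball 0 1" "z \<in> ball 0 1"
  shows "(\<lambda>k. taylor_coeff f k * z ^ k) sums f z"
  using holomorphic_power_series[OF assms]
  by (simp add: taylor_coeff_def fps_expansion_def)

text \<open>
  A rotation of the function only rotates the nodes; from here on all extremal functions are
  convex combinations of kernels.\<close>

lemma rotation_extremal:
  assumes "cmod c = 1"
  shows "rotation c (extremal n m) z =
    (\<Sum>k=1..2*n-2. of_real (m k) * log_kernel (cis (angle n k) * c) z)"
proof -
  have "cnj c * c = 1" using assms by (simp add: mult.commute flip: complex_norm_square)
  moreover have "exp (- \<i> * of_real t) = cnj (cis t)" for t
    by (subst cis_cnj) (simp add: cis_conv_exp)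
  moreover have "cnj c * (a * (2 * E * L - c * z)) = a * (2 * (E * cnj c) * L - (cnj c * c) * z)" for a E L
    by (simp add: algebra_simps)
  ultimately show ?thesis
    unfolding rotation_def extremal_def log_kernel_def sum_distrib_left
    by (simp only: complex_cnj_mult mult_1_left cis_conv_exp[symmetric] mult.assoc)
qed

lemma Re_mult_of_real_left: "Re (of_real a * w) = a * Re w"
  by simp

lemma class_R_log_kernel_mean:
  assumes "finite K" and w: "\<And>k. k \<in> K \<Longrightarrow> cmod (w k) = 1"
    and m: "\<And>k. k \<in> K \<Longrightarrow> 0 \<le> m k" "(\<Sum>k\<in>K. m k) = 1"
    and f: "\<And>z. z \<in> ball 0 1 \<Longrightarrow> f z = (\<Sum>k\<in>K. of_real (m k) * log_kernel (w k) z)"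
  shows "f \<in> class_R"
proof -
  define p where "p z = (\<Sum>k\<in>K. of_real (m k) * ((1 + w k * z) / (1 - w k * z)))" for z
  have der: "(f has_field_derivative p z) (at z)" if z: "z \<in> ball 0 1" for z
  proof (rule has_field_derivative_transform_within_open[where S = "ball 0 1"])
    show "((\<lambda>z. \<Sum>k\<in>K. of_real (m k) * log_kernel (w k) z) has_field_derivative p z) (at z)"
      unfolding p_def
      by (intro DERIV_sum DERIV_cmult log_kernel_has_field_derivative w z)
  qed (use z f in auto)
  have "0 < Re (p z)" if z: "z \<in> ball 0 1" for z
  proof -
    have pos: "0 < Re ((1 + w k * z) / (1 - w k * z))" if "k \<in> K" for k
      using w[OF that] z by (intro Re_cayley_pos) (simp add: norm_mult)
    obtain k where k: "k \<in> K" "m k \<noteq> 0"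
      using m(2) by (metis sum.neutral zero_neq_one)
    have "0 < (\<Sum>k\<in>K. m k * Re ((1 + w k * z) / (1 - w k * z)))"
      using m(1) k pos
      by (intro sum_pos2[OF \<open>finite K\<close> k(1)]) (auto intro!: mult_pos_pos mult_nonneg_nonneg simp: less_le)
    then show ?thesis by (simp only: p_def Re_sum Re_mult_of_real_left)
  qed
  moreover have "deriv f z = p z" if "z \<in> ball 0 1" for z
    using der[OF that] by (rule DERIV_imp_deriv)
  moreover have "f holomorphic_on ball 0 1"
    by (rule holomorphic_onI) (use der in \<open>auto simp: field_differentiable_def intro: DERIV_subset\<close>)
  moreover have "p 0 = 1"
    using m(2) by (simp add: p_def flip: of_real_sum)
  moreover have "f 0 = 0"
    by (simp add: f log_kernel_def)
  ultimately show ?thesis by (simp add: class_R_def)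
qed

lemma taylor_coeff_log_kernel_mean:
  assumes w: "\<And>k. k \<in> K \<Longrightarrow> cmod (w k) = 1"
    and m: "(\<Sum>k\<in>K. m k) = 1"
    and f: "\<And>z. z \<in> ball 0 1 \<Longrightarrow> f z = (\<Sum>k\<in>K. of_real (m k) * log_kernel (w k) z)"
  shows "taylor_coeff f j =
    2 * (\<Sum>k\<in>K. of_real (m k) * w k ^ (j - 1)) / of_nat j - (if j = 1 then 1 else 0)"
proof (rule taylor_coeff_eqI)
  fix z :: complex assume z: "z \<in> ball 0 1"
  have "(\<lambda>j. \<Sum>k\<in>K. of_real (m k) * ((2 * w k ^ (j - 1) / of_nat j - (if j = 1 then 1 else 0)) * z ^ j)) sums f z"
    unfolding f[OF z] by (intro sums_sum sums_mult log_kernel_sums w z)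
  moreover have "(\<Sum>k\<in>K. of_real (m k) * ((2 * w k ^ (j - 1) / of_nat j - (if j = 1 then 1 else 0)) * z ^ j))
     = (2 * (\<Sum>k\<in>K. of_real (m k) * w k ^ (j - 1)) / of_nat j - (if j = 1 then 1 else 0)) * z ^ j" for j
  proof -
    have "(\<Sum>k\<in>K. of_real (m k) * ((2 * w k ^ (j - 1) / of_nat j - (if j = 1 then 1 else 0)) * z ^ j))
      = 2 * (\<Sum>k\<in>K. of_real (m k) * w k ^ (j - 1)) / of_nat j * z ^ j
        - of_real (\<Sum>k\<in>K. m k) * ((if j = 1 then 1 else 0) * z ^ j)"
      unfolding of_real_sum sum_distrib_left sum_distrib_right sum_divide_distrib sum_subtractf[symmetric]
      by (intro sum.cong refl) (simp add: algebra_simps)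
    then show ?thesis by (simp add: m algebra_simps)
  qed
  ultimately show "(\<lambda>j. (2 * (\<Sum>k\<in>K. of_real (m k) * w k ^ (j - 1)) / of_nat j - (if j = 1 then 1 else 0)) * z ^ j) sums f z"
    by simp
qed

section \<open>Taylor coefficients in the Noshiro--Warschawski class\<close>

text \<open>
  The sequence attached to the derivative of \<open>f\<close>, the function that has positive real part.\<close>

definition toeplitz_sequence :: "(complex \<Rightarrow> complex) \<Rightarrow> int \<Rightarrow> complex" where
  "toeplitz_sequence f = hermitian_extension (\<lambda>k. of_nat (Suc k) * taylor_coeff f (Suc k))"

lemma class_R_taylor_coeff:
  assumes "f \<in> class_R"
  shows "taylor_coeff f 0 = 0" "taylor_coeff f 1 = 1"
  using assms by (auto simp: class_R_def taylor_coeff_def fps_expansion_def)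

lemma toeplitz_sequence_positive_definite:
  assumes "f \<in> class_R"
  shows "positive_definite (toeplitz_sequence f)"
proof -
  have "(deriv ^^ k) (deriv f) 0 / fact k = of_nat (Suc k) * taylor_coeff f (Suc k)" for k
  proof -
    have "(deriv ^^ Suc k) f 0 = (deriv ^^ k) (deriv f) 0"
      by (simp only: funpow_Suc_right o_apply)
    moreover have "(of_nat (Suc k) :: complex) \<noteq> 0"
      by (rule of_nat_neq_0)
    ultimately show ?thesis
      by (simp add: taylor_coeff_def fps_expansion_def field_simps del: funpow.simps of_nat_Suc)
  qed
  moreover have "positive_definite (hermitian_extension (\<lambda>k. (deriv ^^ k) (deriv f) 0 / fact k))"
    using assms by (intro positive_definite_coefficients holomorphic_deriv)
      (auto simp: class_R_def intro: less_imp_le)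
  ultimately show ?thesis by (simp add: toeplitz_sequence_def)
qed

lemma toeplitz_sequence_0:
  assumes "f \<in> class_R" shows "toeplitz_sequence f 0 = 2"
  using class_R_taylor_coeff(2)[OF assms] by (simp add: toeplitz_sequence_def hermitian_extension_def)

lemma toeplitz_sequence_pos:
  "0 < k \<Longrightarrow> toeplitz_sequence f (int k) = of_nat (Suc k) * taylor_coeff f (Suc k)"
  by (simp add: toeplitz_sequence_def hermitian_extension_def)

text \<open>
  The \<open>n\<close>-th coefficient of \<open>f\<close> belongs to frequency \<open>n - 1\<close> of the derivative and the coefficient of
  index \<open>2 * n - 1\<close> to twice this frequency; the factors \<open>n\<close> and \<open>2 * n - 1\<close> from differentiation are absorbed in \<open>\<mu>\<close>.\<close>

lemma functional_toeplitz_sequence: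
  fixes lam :: real
  assumes "2 \<le> n"
  defines "\<mu> \<equiv> lam * (2 * real n - 1) / (real n)\<^sup>2"
  shows "cmod (of_real lam * (taylor_coeff f n)\<^sup>2 - taylor_coeff f (2 * n - 1)) =
     cmod (of_real \<mu> * (toeplitz_sequence f (int (n - 1)))\<^sup>2 - toeplitz_sequence f (2 * int (n - 1)))
       / (2 * real n - 1)"
proof -
  define N where "N = n - 1"
  have n: "n = Suc N" and N: "0 < N" "2 * n - 1 = Suc (2 * N)" using assms by (auto simp: N_def)
  have p: "toeplitz_sequence f (int N) = of_nat n * taylor_coeff f n"
    using toeplitz_sequence_pos[OF \<open>0 < N\<close>] by (simp add: n)
  have q: "toeplitz_sequence f (2 * int N) = of_real (2 * real n - 1) * taylor_coeff f (2 * n - 1)"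
    using toeplitz_sequence_pos[of "2 * N"] N by (simp add: n)
  have "of_real \<mu> * (of_nat n * taylor_coeff f n)\<^sup>2 = of_real (2 * real n - 1) * (of_real lam * (taylor_coeff f n)\<^sup>2)"
    using assms(1) by (simp add: \<mu>_def power_mult_distrib)
  then have "of_real \<mu> * (toeplitz_sequence f (int N))\<^sup>2 - toeplitz_sequence f (2 * int N)
     = of_real (2 * real n - 1) * (of_real lam * (taylor_coeff f n)\<^sup>2 - taylor_coeff f (2 * n - 1))"
    unfolding p q by (simp only: right_diff_distrib)
  moreover have "0 < 2 * real n - 1" using assms(1) by simp
  ultimately show ?thesis
    unfolding N_def[symmetric] by (simp only: norm_mult norm_of_real) simp
qed

text \<open>
  The factor \<open>(2 * n - 1) / n\<^sup>2\<close> is largest for \<open>n = 2\<close>, where it is \<open>3/4\<close>. This explains the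
  threshold \<open>4/3\<close>: up to it, \<open>\<mu>\<close> does not exceed \<open>1\<close>.\<close>

lemma fekete_szego_parameter:
  fixes lam :: real
  assumes "2 \<le> n" "0 < lam"
  defines "\<mu> \<equiv> lam * (2 * real n - 1) / (real n)\<^sup>2"
  shows "0 < \<mu>" "\<mu> \<le> 3/4 * lam"
proof -
  show "0 < \<mu>" using assms by (simp add: \<mu>_def)
  have "0 \<le> (3 * real n - 2) * (real n - 2)" using assms by simp
  then have "(2 * real n - 1) / (real n)\<^sup>2 \<le> 3/4"
    using assms(1) by (simp add: field_simps power2_eq_square)
  from mult_left_mono[OF this, of lam] show "\<mu> \<le> 3/4 * lam"
    using assms by (simp add: \<mu>_def)
qed

section \<open>The extremal functions\<close>

lemma sum_admissible_weights:
  assumes "admissible_weights n m" "2 \<le> n"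
  shows "(\<Sum>k=1..2*n-2. m k) = 1"
proof -
  have "2 * n - 2 = 2 * (n - 1)" by simp
  then show ?thesis
    using assms(1) unfolding admissible_weights_def by (simp only: sum_even_odd)
qed

lemma extremal_eq_extremal':
  assumes "admissible_weights n m" "2 \<le> n"
  shows "extremal n m z = extremal' n m z"
proof -
  have "(\<Sum>k=1..2*n-2. of_real (m k) * z) = z"
    using sum_admissible_weights[OF assms] by (simp flip: sum_distrib_right of_real_sum)
  then show ?thesis
    by (simp add: extremal_def extremal'_def right_diff_distrib sum_subtractf mult_ac)
qed

text \<open>
  Balanced weights on the roots of \<open>\<zeta> ^ (2 * N) = -1\<close> make the coefficient at frequency \<open>N\<close> vanish, while all
  terms of the coefficient at frequency \<open>2 * N\<close> point in the same direction. Rotation changes only the direction.\<close>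

lemma extremal_attains:
  assumes n: "2 \<le> n" and m: "admissible_weights n m" and c: "cmod c = 1"
    and f: "\<And>z. z \<in> ball 0 1 \<Longrightarrow> f z = rotation c (extremal n m) z"
  shows "f \<in> class_R"
    and "cmod (of_real lam * (taylor_coeff f n)\<^sup>2 - taylor_coeff f (2*n-1)) = 2 / (2 * real n - 1)"
proof -
  define N where "N = n - 1"
  have N: "0 < N" "2 * n - 2 = 2 * N" "2 * n - 1 - 1 = 2 * N" "2 * n - 1 \<noteq> 1" using n by (auto simp: N_def)
  define w where "w k = cis (node (2 * N) k) * c" for k
  have w: "cmod (w k) = 1" for k using c by (simp add: w_def norm_mult)
  have f': "f z = (\<Sum>k=1..2*N. of_real (m k) * log_kernel (w k) z)" if "z \<in> ball 0 1" for z
    using f[OF that] rotation_extremal[OF c] by (simp add: N w_def angle_eq_node[OF n] N_def)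
  have sum: "(\<Sum>k=1..2*N. m k) = 1" using sum_admissible_weights[OF m n] by (simp add: N)
  show "f \<in> class_R"
    by (rule class_R_log_kernel_mean[where K = "{1..2*N}", OF _ w _ sum f'])
       (use m in \<open>auto simp: admissible_weights_def N\<close>)
  have coeff: "taylor_coeff f j = 2 * (\<Sum>k=1..2*N. of_real (m k) * w k ^ (j - 1)) / of_nat j
      - (if j = 1 then 1 else 0)" for j
    by (rule taylor_coeff_log_kernel_mean[OF w sum f'])
  have "(\<Sum>k=1..2*N. of_real (m k) * w k ^ N) = c ^ N * (\<Sum>k=1..2*N. of_real (m k) * cis (real N * node (2*N) k))"
    by (simp add: w_def power_mult_distrib Complex.DeMoivre sum_distrib_left mult_ac)
  also have "\<dots> = 0"
    using m unfolding sum_cis_node_half[OF N(1)] admissible_weights_def N_def[symmetric]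
    by (simp only: diff_self of_real_0 mult_zero_right)
  finally have "taylor_coeff f n = 0"
    using n unfolding coeff N_def[symmetric] by simp
  moreover have "taylor_coeff f (2*n-1) = - 2 * c ^ (2 * N) / of_nat (2 * n - 1)"
  proof -
    have "w k ^ (2 * N) = - (c ^ (2 * N))" for k
      using cis_node_period[of "2 * N" k] N(1) by (simp add: w_def power_mult_distrib Complex.DeMoivre)
    then have "(\<Sum>k=1..2*N. of_real (m k) * w k ^ (2 * N)) = - (of_real (\<Sum>k=1..2*N. m k) * c ^ (2 * N))"
      by (simp add: sum_negf sum_distrib_right)
    then show ?thesis using N unfolding coeff sum by simp
  qed
  moreover have "real (2 * n - 1) = 2 * real n - 1" using n by simp
  ultimately show "cmod (of_real lam * (taylor_coeff f n)\<^sup>2 - taylor_coeff f (2*n-1)) = 2 / (2 * real n - 1)"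
    using c n by (simp add: norm_divide norm_mult norm_power del: of_nat_diff)
qed

text \<open>
  After a rotation the coefficient at frequency \<open>2 * N\<close> is \<open>-2\<close>, so the coefficient sequence is a
  discrete Fourier transform of nonnegative masses on the required nodes. Their total is half of the
  value at frequency \<open>0\<close>, and the vanishing coefficient at frequency \<open>N\<close> makes them balanced. The rotated extremal function with these masses
  then has the Taylor coefficients of \<open>f\<close>.\<close>

lemma extremal_coefficients:
  assumes f: "f \<in> class_R" and n: "2 \<le> n"
    and p: "toeplitz_sequence f (int (n - 1)) = 0"
    and q: "cmod (toeplitz_sequence f (2 * int (n - 1))) = 2"
  shows "\<exists>c m. norm c = 1 \<and> admissible_weights n m \<and> (\<forall>z\<in>ball 0 1. f z = rotation c (extremal n m) z)"
proof -
  define N where "N = n - 1"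
  have N: "0 < N" "2 * n - 2 = 2 * N" "2 * n - 1 - 1 = 2 * N" using n by (auto simp: N_def)
  \<comment> \<open>The phase is divided by \<open>2 * N\<close> because modulation multiplies the coefficient by \<open>cis (2 * N * s)\<close>.\<close>
  define s where "s = - Arg (- toeplitz_sequence f (2 * int N)) / real (2 * N)"
  define b where "b d = toeplitz_sequence f d * cis (of_int d * s)" for d
  have pd: "positive_definite b"
    unfolding b_def by (intro positive_definite_modulate toeplitz_sequence_positive_definite f)
  have b0: "b 0 = 2" by (simp add: b_def toeplitz_sequence_0 f)
  have bM: "b (int (2 * N)) = -2"
  proof -
    define t where "t = - toeplitz_sequence f (2 * int N)"
    have "t = 2 * cis (Arg t)"
      using rcis_cmod_Arg[of t] q by (simp add: rcis_def t_def N_def)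
    moreover have "of_int (int (2 * N)) * s = - Arg t"
      using N by (simp add: s_def t_def)
    ultimately have "t * cis (of_int (int (2 * N)) * s) = 2"
      by (metis (no_types, lifting) add.right_inverse cis_mult cis_zero mult.assoc mult.right_neutral)
    then have "- b (int (2 * N)) = 2" by (simp add: b_def t_def)
    then show ?thesis by (metis minus_minus)
  qed
  obtain m where m: "\<And>k. 0 \<le> m k"
    "\<And>d. b d = 2 * (\<Sum>k=1..2*N. of_real (m k) * cis (of_int d * node (2 * N) k))"
    using positive_definite_discrete[OF pd b0 _ bM] N by auto
  have sum: "(\<Sum>k=1..2*N. m k) = 1"
  proof -
    have "complex_of_real (\<Sum>k=1..2*N. m k) = 1"
      using m(2)[of 0] b0 by simp
    then show ?thesis by (simp only: of_real_eq_1_iff)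
  qed
  have halves: "(\<Sum>k=1..N. m (2*k)) = (\<Sum>k=1..N. m (2*k-1))"
  proof -
    have "b (int N) = 0" using p by (simp add: b_def N_def)
    then have "(\<Sum>k=1..2*N. of_real (m k) * cis (real N * node (2*N) k)) = 0"
      using m(2)[of "int N"] by simp
    then show ?thesis
      unfolding sum_cis_node_half[OF N(1)] by (simp del: of_real_diff)
  qed
  have "m k \<le> 1" if "k \<in> {1..2*N}" for k
    using member_le_sum[of k "{1..2*N}" m] that m(1) sum by simp
  then have adm: "admissible_weights n m"
    using m(1) halves sum unfolding admissible_weights_def sum_even_odd N by (simp add: N_def)
  \<comment> \<open>Undoing the modulation by \<open>s\<close> is the rotation that relates the extremal function to \<open>f\<close>.\<close>
  define c where "c = cis (- s)"
  have c: "cmod c = 1" by (simp add: c_def)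
  define w where "w k = cis (node (2 * N) k) * c" for k
  have w: "cmod (w k) = 1" for k using c by (simp add: w_def norm_mult)
  define h where "h = rotation c (extremal n m)"
  have h: "h z = (\<Sum>k=1..2*N. of_real (m k) * log_kernel (w k) z)" for z
    using rotation_extremal[OF c] by (simp add: h_def N w_def angle_eq_node[OF n] N_def)
  have hR: "h \<in> class_R"
    using extremal_attains(1)[OF n adm c] by (simp add: h_def)
  have "taylor_coeff f j = taylor_coeff h j" for j
  proof -
    consider "j = 0" | "j = 1" | i where "0 < i" "j = Suc i"
      by (metis One_nat_def gr0I not0_implies_Suc)
    then show ?thesis
    proof cases
      case 3
      have "2 * (\<Sum>k=1..2*N. of_real (m k) * w k ^ i) = b (int i) * c ^ i"
        unfolding m(2)
        by (simp add: w_def power_mult_distrib Complex.DeMoivre sum_distrib_left mult_ac)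
      also have "\<dots> = toeplitz_sequence f (int i)"
        by (simp add: b_def c_def Complex.DeMoivre mult.assoc cis_mult)
      also have "\<dots> = of_nat j * taylor_coeff f j"
        using 3 by (simp add: toeplitz_sequence_pos)
      finally show ?thesis
        using 3 taylor_coeff_log_kernel_mean[where K = "{1..2*N}", OF w sum h, of j]
        by (simp del: of_nat_Suc)
    qed (use class_R_taylor_coeff f hR in auto)
  qed
  moreover have "f holomorphic_on ball 0 1" "h holomorphic_on ball 0 1"
    using f hR by (auto simp: class_R_def)
  ultimately have "f z = h z" if "z \<in> ball 0 1" for z
    using taylor_coeff_sums[of f z] taylor_coeff_sums[of h z] that by (auto intro: sums_unique2)
  with c adm show ?thesis unfolding h_def by blast
qed

theorem theorem4:
  fixes lam :: real
  assumes "0 < lam" and "lam \<le> 4/3"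
  shows "(\<forall>f\<in>class_R. \<forall>n\<ge>2.
            norm (of_real lam * (taylor_coeff f n)\<^sup>2 - taylor_coeff f (2*n-1)) \<le> 2 / (2 * real n - 1))
       \<and> (lam < 4/3 \<longrightarrow>
            (\<forall>n\<ge>2.
               (\<forall>f. (f \<in> class_R \<and>
                     norm (of_real lam * (taylor_coeff f n)\<^sup>2 - taylor_coeff f (2*n-1)) = 2 / (2 * real n - 1))
                  \<longleftrightarrow> (\<exists>c m. norm c = 1 \<and> admissible_weights n m \<and>
                         (\<forall>z\<in>ball 0 1. f z = rotation c (extremal n m) z)))
             \<and> (\<forall>m. admissible_weights n m \<longrightarrow>
                  (\<forall>z\<in>ball 0 1. extremal n m z = extremal' n m z))))"
proof -
  define \<mu> where "\<mu> n = lam * (2 * real n - 1) / (real n)\<^sup>2" for n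
  have \<mu>: "0 < \<mu> n" "\<mu> n \<le> 3/4 * lam" if "2 \<le> n" for n
    unfolding \<mu>_def by (rule fekete_szego_parameter[OF that assms(1)])+
  have bound: "cmod (of_real (\<mu> n) * (toeplitz_sequence f (int (n - 1)))\<^sup>2 - toeplitz_sequence f (2 * int (n - 1)))
      \<le> 2 - (1/2 - \<bar>\<mu> n - 1/2\<bar>) * (cmod (toeplitz_sequence f (int (n - 1))))\<^sup>2" if "f \<in> class_R" for f n
    by (intro fekete_szego_positive_definite toeplitz_sequence_positive_definite toeplitz_sequence_0 that)
  have ineq: "norm (of_real lam * (taylor_coeff f n)\<^sup>2 - taylor_coeff f (2*n-1)) \<le> 2 / (2 * real n - 1)"
    if f: "f \<in> class_R" and n: "2 \<le> n" for f n
  proof -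
    have "0 < \<mu> n" "\<mu> n \<le> 1"
      using \<mu>[OF n] assms(2) by linarith+
    then have "0 \<le> (1/2 - \<bar>\<mu> n - 1/2\<bar>) * (cmod (toeplitz_sequence f (int (n - 1))))\<^sup>2"
      by (intro mult_nonneg_nonneg zero_le_power2) linarith
    with bound[OF f, of n] show ?thesis
      using n unfolding functional_toeplitz_sequence[OF n] \<mu>_def[symmetric]
      by (intro divide_right_mono) auto
  qed
  have eq: "\<exists>c m. norm c = 1 \<and> admissible_weights n m \<and> (\<forall>z\<in>ball 0 1. f z = rotation c (extremal n m) z)"
    if lam: "lam < 4/3" and f: "f \<in> class_R" and n: "2 \<le> n"
      and e: "norm (of_real lam * (taylor_coeff f n)\<^sup>2 - taylor_coeff f (2*n-1)) = 2 / (2 * real n - 1)" for f n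
  proof -
    \<comment> \<open>Strictness of \<open>\<mu> n < 1\<close> is what forces the coefficient at frequency \<open>n - 1\<close> to vanish.\<close>
    have "0 < \<mu> n" "\<mu> n < 1"
      using \<mu>[OF n] lam by linarith+
    then have gap: "0 < 1/2 - \<bar>\<mu> n - 1/2\<bar>" by linarith
    have e': "cmod (of_real (\<mu> n) * (toeplitz_sequence f (int (n - 1)))\<^sup>2 - toeplitz_sequence f (2 * int (n - 1))) = 2"
      using e n unfolding functional_toeplitz_sequence[OF n] \<mu>_def[symmetric] by (simp add: field_simps)
    with bound[OF f, of n] have "(1/2 - \<bar>\<mu> n - 1/2\<bar>) * (cmod (toeplitz_sequence f (int (n - 1))))\<^sup>2 \<le> 0"
      by simp
    with gap have "toeplitz_sequence f (int (n - 1)) = 0"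
      by (simp add: mult_le_0_iff)
    with e' show ?thesis
      by (intro extremal_coefficients f n) auto
  qed
  show ?thesis
  proof (intro conjI ballI allI impI iffI)
    fix n :: nat and f assume "2 \<le> n"
      and "\<exists>c m. norm c = 1 \<and> admissible_weights n m \<and> (\<forall>z\<in>ball 0 1. f z = rotation c (extremal n m) z)"
    then obtain c m where "admissible_weights n m" "norm c = 1"
      "\<And>z. z \<in> ball 0 1 \<Longrightarrow> f z = rotation c (extremal n m) z" by blast
    from extremal_attains[OF \<open>2 \<le> n\<close> this] show "f \<in> class_R"
      and "norm (of_real lam * (taylor_coeff f n)\<^sup>2 - taylor_coeff f (2*n-1)) = 2 / (2 * real n - 1)"
      by simp_all
  next
    fix n :: nat and f assume "lam < 4/3" "2 \<le> n" and "f \<in> class_R \<and>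
      norm (of_real lam * (taylor_coeff f n)\<^sup>2 - taylor_coeff f (2*n-1)) = 2 / (2 * real n - 1)"
    then show "\<exists>c m. norm c = 1 \<and> admissible_weights n m \<and> (\<forall>z\<in>ball 0 1. f z = rotation c (extremal n m) z)"
      by (intro eq) auto
  qed (simp_all only: ineq extremal_eq_extremal')
qed

end
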